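(* Let $n\ge1$ be an integer and $K_n$ the complete graph on $n$ vertices. (a) $K_n$ is $\{-1,0,1\}$-diagonalizable, with $\{-1,0,1\}$-bandwidth at most $2$. (b) $K_n$ is $\{-1,1\}$-diagonalizable if and only if $n=1$ or $n$ is even. Furthermore: (i) if $n\equiv 2\pmod 4$ then $K_n$ has $\{-1,1\}$-bandwidth $n-1$; and (ii) if there exists a Hadamard matrix of order $n$, then $K_n$ has $\{-1,1\}$-bandwidth $1$.
   Context: For a simple graph with adjacency matrix $A$ and degree matrix $D$, the Laplacian is $L=D-A$. For a set $S$, a graph is $S$-diagonalizable if there is an invertible matrix $P$ with all entries in $S$ such that $P^{-1}LP$ is diagonal. The bandwidth of a square matrix $M$ is the smallest positive integer $k$ with $m_{i,j}=0$ whenever $|i-j|\ge k$. The $S$-bandwidth of an $S$-diagonalizable graph is the smallest positive integer $k$ for which there is a matrix $P$ with entries in $S$, $P^{-1}LP$ diagonal and $P^TP$ of bandwidth $k$ (and $\infty$ if the graph is not $S$-diagonalizable). A Hadamard matrix of order $n$ is an $n\times n$ matrix with entries in $\{-1,1\}$ whose columns are mutually orthogonal. *)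

theory Defs
  imports
    "Jordan_Normal_Form.Matrix"
    "Graph_Theory.Kuratowski"
    "HOL-Library.Extended_Nat"
    Complex_Main
begin

text \<open>
  A simple graph is a finite, symmetric, loop-free digraph without parallel arcs (locale
  \<^locale>\<open>graph\<close>), so the degree of a vertex is its out-degree. Matrices are indexed from 0 and
  are formed with respect to an enumeration \<open>vs\<close> of the vertices (a distinct list with
  \<open>set vs = verts G\<close>). Another enumeration only permutes the rows of a diagonalizing matrix \<open>P\<close>
  and leaves \<open>P\<^sup>T P\<close> unchanged.
\<close>

definition adjacency_matrix :: "('a, 'b) pre_digraph \<Rightarrow> 'a list \<Rightarrow> real mat" where
  "adjacency_matrix G vs =
     mat (length vs) (length vs) (\<lambda>(i, j). if (vs ! i) \<rightarrow>\<^bsub>G\<^esub> (vs ! j) then 1 else 0)"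

definition degree_matrix :: "('a, 'b) pre_digraph \<Rightarrow> 'a list \<Rightarrow> real mat" where
  "degree_matrix G vs =
     mat (length vs) (length vs) (\<lambda>(i, j). if i = j then real (out_degree G (vs ! i)) else 0)"

definition laplacian_matrix :: "('a, 'b) pre_digraph \<Rightarrow> 'a list \<Rightarrow> real mat" where
  "laplacian_matrix G vs = degree_matrix G vs - adjacency_matrix G vs"

text \<open>In the next definition \<open>Q\<close> is the inverse of \<open>P\<close>.\<close>

definition diagonalizes_over :: "real set \<Rightarrow> real mat \<Rightarrow> real mat \<Rightarrow> bool" where
  "diagonalizes_over S L P \<longleftrightarrow>
     P \<in> carrier_mat (dim_row L) (dim_row L) \<and> elements_mat P \<subseteq> S \<and>
     (\<exists>Q \<in> carrier_mat (dim_row L) (dim_row L).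
        inverts_mat P Q \<and> inverts_mat Q P \<and> diagonal_mat (Q * L * P))"

definition S_diagonalizable :: "real set \<Rightarrow> ('a, 'b) pre_digraph \<Rightarrow> 'a list \<Rightarrow> bool" where
  "S_diagonalizable S G vs \<longleftrightarrow> (\<exists>P. diagonalizes_over S (laplacian_matrix G vs) P)"

definition matrix_bandwidth :: "real mat \<Rightarrow> nat" where
  "matrix_bandwidth M =
     (LEAST k. k \<ge> 1 \<and>
        (\<forall>i < dim_row M. \<forall>j < dim_col M. \<bar>int i - int j\<bar> \<ge> int k \<longrightarrow> M $$ (i, j) = 0))"

definition S_bandwidth :: "real set \<Rightarrow> ('a, 'b) pre_digraph \<Rightarrow> 'a list \<Rightarrow> enat" where
  "S_bandwidth S G vs =
     (if S_diagonalizable S G vs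
      then enat (LEAST k. k \<ge> 1 \<and>
        (\<exists>P. diagonalizes_over S (laplacian_matrix G vs) P \<and>
             matrix_bandwidth (transpose_mat P * P) = k))
      else \<infinity>)"

definition hadamard_matrix :: "nat \<Rightarrow> real mat \<Rightarrow> bool" where
  "hadamard_matrix n H \<longleftrightarrow>
     H \<in> carrier_mat n n \<and> elements_mat H \<subseteq> {-1, 1} \<and>
     (\<forall>i < n. \<forall>j < n. i \<noteq> j \<longrightarrow> col H i \<bullet> col H j = 0)"

end

theory Submission
  imports Defs "Jordan_Normal_Form.Determinant"
begin

text \<open>The Laplacian of \<open>K\<^sub>n\<close> is \<open>n I - J\<close> with \<open>J\<close> the all-ones matrix, so \<open>P\<close> diagonalizes it
  if and only if \<open>P\<close> is invertible, one column of \<open>P\<close> is constant and the others sum to zero.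
  The differences of consecutive unit vectors together with the all-ones vector have a
  tridiagonal Gram matrix. A sign vector with sum zero has even length, and two such vectors
  can be orthogonal only if 4 divides their length; hence for \<open>n mod 4 = 2\<close> only the constant
  column can produce zeros in \<open>P\<^sup>T P\<close>, and the best place for it is at the border. Negating rows
  turns a Hadamard matrix into one whose first column is constant.\<close>

section \<open>Gram matrices and invertibility\<close>

lemma transpose_times_index:
  fixes P :: "real mat"
  assumes "P \<in> carrier_mat n m" "i < m" "j < m"
  shows "(transpose_mat P * P) $$ (i, j) = (\<Sum>k = 0..<n. P $$ (k, i) * P $$ (k, j))"
  using assms by (auto simp: scalar_prod_def intro!: sum.cong)

lemma ex_inverse_mat:
  fixes P :: "'a::field mat"
  assumes P: "P \<in> carrier_mat n n" and det: "det P \<noteq> 0"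
  shows "\<exists>Q \<in> carrier_mat n n. inverts_mat P Q \<and> inverts_mat Q P"
proof -
  from det_non_zero_imp_unit[OF P det, of "()"] obtain Q
    where "Q \<in> carrier_mat n n" "Q * P = 1\<^sub>m n" "P * Q = 1\<^sub>m n"
    unfolding Units_def ring_mat_def by auto
  then show ?thesis using P unfolding inverts_mat_def by auto
qed

text \<open>A singular \<open>P\<close> has a singular transpose, whose kernel contains a nonzero
  vector orthogonal to all columns of \<open>P\<close>. This certifies invertibility of the explicit
  matrices below without computing determinants; \<open>y\<close> is a plain function so that their
  weighted column sums apply directly.\<close>

lemma det_nonzero_if_row_kernel_trivial:
  fixes P :: "'a::field mat"
  assumes P: "P \<in> carrier_mat n n"
    and ker: "\<And>y i. (\<And>k. k < n \<Longrightarrow> (\<Sum>j = 0..<n. P $$ (j, k) * y j) = 0) \<Longrightarrow> i < n \<Longrightarrow> y i = 0"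
  shows "det P \<noteq> 0"
proof
  assume "det P = 0"
  then have "det (transpose_mat P) = 0" by (simp add: det_transpose[OF P])
  then obtain v where v: "v \<in> carrier_vec n" "v \<noteq> 0\<^sub>v n" "transpose_mat P *\<^sub>v v = 0\<^sub>v n"
    using det_0_iff_vec_prod_zero_field[of "transpose_mat P" n] P by auto
  have "(\<Sum>j = 0..<n. P $$ (j, k) * v $ j) = 0" if "k < n" for k
  proof -
    have "(\<Sum>j = 0..<n. P $$ (j, k) * v $ j) = (transpose_mat P *\<^sub>v v) $ k"
      using that P v(1) by (auto simp: scalar_prod_def intro!: sum.cong)
    then show ?thesis using v(3) that by simp
  qed
  then have "v $ i = 0" if "i < n" for i
    using ker[of "\<lambda>i. v $ i" i] that by blast
  then have "v = 0\<^sub>v n" using v(1) by auto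
  then show False using v(2) by simp
qed

section \<open>Bandwidth of matrices and of graphs\<close>

lemma matrix_bandwidth_le:
  assumes "k \<ge> 1"
    and "\<And>i j. i < dim_row M \<Longrightarrow> j < dim_col M \<Longrightarrow> \<bar>int i - int j\<bar> \<ge> int k \<Longrightarrow> M $$ (i, j) = 0"
  shows "matrix_bandwidth M \<le> k"
  unfolding matrix_bandwidth_def by (rule Least_le) (use assms in auto)

lemma
  shows matrix_bandwidth_ge_1: "matrix_bandwidth M \<ge> 1"
    and matrix_bandwidth_zero:
      "i < dim_row M \<Longrightarrow> j < dim_col M \<Longrightarrow> \<bar>int i - int j\<bar> \<ge> int (matrix_bandwidth M) \<Longrightarrow> M $$ (i, j) = 0"
proof -
  let ?B = "\<lambda>k. k \<ge> 1 \<and>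
    (\<forall>i < dim_row M. \<forall>j < dim_col M. \<bar>int i - int j\<bar> \<ge> int k \<longrightarrow> M $$ (i, j) = 0)"
  \<comment> \<open>No two indices are this far apart, so the condition holds vacuously and the
    \<open>LEAST\<close> is attained.\<close>
  have "?B (dim_row M + dim_col M + 1)" by auto
  then have *: "?B (matrix_bandwidth M)"
    unfolding matrix_bandwidth_def by (rule LeastI)
  show "matrix_bandwidth M \<ge> 1" using * by blast
  show "i < dim_row M \<Longrightarrow> j < dim_col M \<Longrightarrow> \<bar>int i - int j\<bar> \<ge> int (matrix_bandwidth M) \<Longrightarrow> M $$ (i, j) = 0"
    using * by blast
qed

lemma matrix_bandwidth_less_imp_zero:
  assumes "i < dim_row M" "j < dim_col M" "M $$ (i, j) \<noteq> 0"
  shows "\<bar>int i - int j\<bar> < int (matrix_bandwidth M)"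
  using matrix_bandwidth_zero[of i M j] assms by linarith

lemma S_bandwidth_le:
  assumes "diagonalizes_over S (laplacian_matrix G vs) P"
  shows "S_bandwidth S G vs \<le> enat (matrix_bandwidth (transpose_mat P * P))"
  using assms matrix_bandwidth_ge_1[of "transpose_mat P * P"]
  unfolding S_bandwidth_def S_diagonalizable_def by (auto intro!: Least_le)

text \<open>For a diagonalizable graph the minimum is attained by some \<open>P\<close>, so a bound
  valid for every \<open>P\<close> passes to it; otherwise the right-hand side is infinite.\<close>

lemma S_bandwidth_ge:
  assumes "\<And>P. diagonalizes_over S (laplacian_matrix G vs) P \<Longrightarrow>
    k \<le> matrix_bandwidth (transpose_mat P * P)"
  shows "enat k \<le> S_bandwidth S G vs"
proof (cases "S_diagonalizable S G vs")
  case True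
  let ?B = "\<lambda>k. k \<ge> 1 \<and> (\<exists>P. diagonalizes_over S (laplacian_matrix G vs) P \<and>
    matrix_bandwidth (transpose_mat P * P) = k)"
  obtain P where P: "diagonalizes_over S (laplacian_matrix G vs) P"
    using True unfolding S_diagonalizable_def by blast
  then have "?B (matrix_bandwidth (transpose_mat P * P))"
    using matrix_bandwidth_ge_1 by blast
  then have B: "?B (Least ?B)" by (rule LeastI)
  have "k \<le> Least ?B"
    by (rule exE[OF conjunct2[OF B]]) (use assms in metis)
  then show ?thesis using True unfolding S_bandwidth_def by simp
qed (simp add: S_bandwidth_def)

section \<open>The Laplacian of the complete graph and its eigenvectors\<close>

text \<open>Free of the graph and of the enumeration \<open>vs\<close>, so all that follows except
  the final theorem is pure matrix theory.\<close>

definition complete_laplacian :: "nat \<Rightarrow> real mat" where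
  "complete_laplacian n = mat n n (\<lambda>(i, j). if i = j then real n - 1 else -1)"

lemma complete_laplacian_carrier [simp]: "complete_laplacian n \<in> carrier_mat n n"
  by (simp add: complete_laplacian_def)

lemma complete_laplacian_dim [simp]:
  "dim_row (complete_laplacian n) = n" "dim_col (complete_laplacian n) = n"
  by (simp_all add: complete_laplacian_def)

text \<open>Without parallel arcs, \<open>head G\<close> is injective on the arcs leaving
  \<open>v\<close>, so counting them amounts to counting the other vertices.\<close>

lemma out_degree_complete:
  assumes G: "complete_digraph n G" and v: "v \<in> verts G"
  shows "out_degree G v = n - 1"
proof -
  from G interpret graph G by (simp add: complete_digraph_def)
  have ends: "arcs_ends G = {(u, v). u \<in> verts G \<and> v \<in> verts G \<and> u \<noteq> v}"
    and card: "card (verts G) = n"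
    using G by (auto simp: complete_digraph_def)
  have inj: "inj_on (head G) (out_arcs G v)"
    by (rule inj_onI) (auto intro!: no_multi_arcs simp: arc_to_ends_def)
  have "head G ` out_arcs G v = {u. (v, u) \<in> arcs_ends G}"
    by (force simp: arcs_ends_def arc_to_ends_def)
  also have "\<dots> = verts G - {v}" using v by (auto simp: ends)
  finally have "card (out_arcs G v) = card (verts G - {v})"
    using card_image[OF inj] by simp
  then show ?thesis using v card by (simp add: out_degree_def)
qed

lemma laplacian_matrix_complete:
  assumes n: "n \<ge> 1" and G: "complete_digraph n G"
    and vs: "distinct vs" "set vs = verts G"
  shows "laplacian_matrix G vs = complete_laplacian n"
proof -
  have card: "card (verts G) = n" and
    ends: "arcs_ends G = {(u, v). u \<in> verts G \<and> v \<in> verts G \<and> u \<noteq> v}"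
    using G by (auto simp: complete_digraph_def)
  have len: "length vs = n" using vs card distinct_card by metis
  have "vs ! i \<in> verts G" if "i < n" for i using that vs len nth_mem by metis
  then show ?thesis
    using n len vs(1) unfolding laplacian_matrix_def degree_matrix_def adjacency_matrix_def
      complete_laplacian_def
    by (intro eq_matI) (auto simp: ends out_degree_complete[OF G] nth_eq_iff_index_eq)
qed

text \<open>Multiplication by the all-ones matrix replaces each entry by its column sum. Being an
  eigenvector thus becomes a condition on column sums.\<close>

lemma complete_laplacian_times_index:
  assumes P: "P \<in> carrier_mat n n" and "i < n" "k < n"
  shows "(complete_laplacian n * P) $$ (i, k) = real n * P $$ (i, k) - (\<Sum>j = 0..<n. P $$ (j, k))"
proof -
  have "(complete_laplacian n * P) $$ (i, k)
      = (\<Sum>j = 0..<n. (if i = j then real n - 1 else -1) * P $$ (j, k))"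
    using assms by (auto simp: complete_laplacian_def scalar_prod_def intro!: sum.cong)
  also have "\<dots> = (\<Sum>j = 0..<n. (if i = j then real n * P $$ (j, k) else 0) - P $$ (j, k))"
    by (rule sum.cong) (auto simp: algebra_simps)
  also have "\<dots> = real n * P $$ (i, k) - (\<Sum>j = 0..<n. P $$ (j, k))"
    using assms by (simp add: sum_subtractf)
  finally show ?thesis .
qed

lemma diagonalizes_complete_laplacianI:
  assumes P: "P \<in> carrier_mat n n" and S: "\<And>i k. i < n \<Longrightarrow> k < n \<Longrightarrow> P $$ (i, k) \<in> S"
    and det: "det P \<noteq> 0"
    and const: "\<And>i. i < n \<Longrightarrow> P $$ (i, 0) = 1"
    and zero: "\<And>k. k < n \<Longrightarrow> k \<noteq> 0 \<Longrightarrow> (\<Sum>j = 0..<n. P $$ (j, k)) = 0"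
  shows "diagonalizes_over S (complete_laplacian n) P"
proof -
  obtain Q where Q: "Q \<in> carrier_mat n n" "inverts_mat P Q" "inverts_mat Q P"
    using ex_inverse_mat[OF P det] by blast
  \<comment> \<open>The constant column has eigenvalue 0; every column with sum zero has eigenvalue
    \<open>n\<close>.\<close>
  define D where "D = mat n n (\<lambda>(i, j). if i = j \<and> i \<noteq> 0 then real n else 0)"
  have D: "D \<in> carrier_mat n n" by (simp add: D_def)
  have "complete_laplacian n * P = P * D"
  proof (rule eq_matI)
    fix i k assume "i < dim_row (P * D)" "k < dim_col (P * D)"
    then have ik: "i < n" "k < n" using P D by auto
    have "(P * D) $$ (i, k) = (\<Sum>j = 0..<n. P $$ (i, j) * (if j = k \<and> j \<noteq> 0 then real n else 0))"
      using P ik by (auto simp: D_def scalar_prod_def intro!: sum.cong)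
    also have "\<dots> = (\<Sum>j = 0..<n. if j = k then (if k \<noteq> 0 then P $$ (i, k) * real n else 0) else 0)"
      by (rule sum.cong) auto
    also have "\<dots> = (if k \<noteq> 0 then P $$ (i, k) * real n else 0)"
      using ik by simp
    finally show "(complete_laplacian n * P) $$ (i, k) = (P * D) $$ (i, k)"
      using complete_laplacian_times_index[OF P ik] const zero ik by (cases "k = 0") auto
  qed (use P D in auto)
  moreover have "Q * complete_laplacian n * P = Q * (complete_laplacian n * P)"
    using assoc_mult_mat[OF Q(1) complete_laplacian_carrier P] .
  moreover have "Q * (P * D) = D"
    using assoc_mult_mat[OF Q(1) P D] Q D unfolding inverts_mat_def by simp
  ultimately have "diagonal_mat (Q * complete_laplacian n * P)"
    by (simp add: D_def diagonal_mat_def)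
  moreover have "elements_mat P \<subseteq> S" using S P by auto
  ultimately show ?thesis using P Q unfolding diagonalizes_over_def by auto
qed

text \<open>A column that does not sum to zero is constant, and two constant columns would be linearly
  dependent.\<close>

lemma diagonalizes_complete_laplacianD:
  assumes "diagonalizes_over S (complete_laplacian n) P"
  obtains c where "\<And>k. k < n \<Longrightarrow> k \<noteq> c \<Longrightarrow> (\<Sum>j = 0..<n. P $$ (j, k)) = 0"
proof -
  let ?s = "\<lambda>k. \<Sum>j = 0..<n. P $$ (j, k)"
  from assms obtain Q where P: "P \<in> carrier_mat n n" and Q: "Q \<in> carrier_mat n n"
    and inv: "P * Q = 1\<^sub>m n" "Q * P = 1\<^sub>m n" and diag: "diagonal_mat (Q * complete_laplacian n * P)"
    unfolding diagonalizes_over_def inverts_mat_def by auto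
  define D where "D = Q * complete_laplacian n * P"
  have D: "D \<in> carrier_mat n n"
    unfolding D_def by (intro mult_carrier_mat[OF mult_carrier_mat[OF Q complete_laplacian_carrier] P])
  \<comment> \<open>Cancelling \<open>P * Q\<close> turns the similarity into the statement that the
    columns of \<open>P\<close> are eigenvectors.\<close>
  have "P * D = P * (Q * (complete_laplacian n * P))"
    unfolding D_def using assoc_mult_mat[OF Q complete_laplacian_carrier P] by simp
  also have "\<dots> = complete_laplacian n * P"
    using assoc_mult_mat[OF P Q mult_carrier_mat[OF complete_laplacian_carrier P]] inv P
    by (simp add: left_mult_one_mat[OF mult_carrier_mat[OF complete_laplacian_carrier P]])
  finally have PD: "P * D = complete_laplacian n * P" .
  \<comment> \<open>The eigenvector equation below shows that the denominator is nonzero whenever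
    the column sum is, so no division by zero occurs where \<open>t\<close> is used.\<close>
  define t where "t k = ?s k / (real n - D $$ (k, k))" for k
  have const: "P $$ (i, k) = t k" if ik: "i < n" "k < n" and s: "?s k \<noteq> 0" for i k
  proof -
    have "(P * D) $$ (i, k) = (\<Sum>j = 0..<n. P $$ (i, j) * D $$ (j, k))"
      using P D ik by (auto simp: scalar_prod_def intro!: sum.cong)
    also have "\<dots> = (\<Sum>j = 0..<n. if j = k then P $$ (i, k) * D $$ (k, k) else 0)"
      using diag D ik by (intro sum.cong) (auto simp: diagonal_mat_def D_def[symmetric])
    also have "\<dots> = P $$ (i, k) * D $$ (k, k)" using ik by simp
    finally have "P $$ (i, k) * D $$ (k, k) = real n * P $$ (i, k) - ?s k"
      using complete_laplacian_times_index[OF P ik] PD by simp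
    then have "(real n - D $$ (k, k)) * P $$ (i, k) = ?s k" by (simp add: algebra_simps)
    then show ?thesis using s unfolding t_def
      by (metis mult_zero_left nonzero_mult_div_cancel_left)
  qed
  have uniq: "k = k'" if k: "k < n" "k' < n" and s: "?s k \<noteq> 0" "?s k' \<noteq> 0" for k k'
  proof (rule ccontr)
    assume "k \<noteq> k'"
    \<comment> \<open>Row \<open>k\<close> of \<open>Q\<close> pairs with a constant column to
      \<open>q\<close> times its value. The entry 1 of \<open>Q * P\<close> at \<open>(k, k)\<close>
      forces \<open>q\<close> to be nonzero, so the entry 0 at \<open>(k, k')\<close> would force
      the constant column \<open>k'\<close> to vanish.\<close>
    define q where "q = (\<Sum>i = 0..<n. Q $$ (k, i))"
    have QP: "(Q * P) $$ (k, l) = q * t l" if "l < n" "?s l \<noteq> 0" for l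
    proof -
      have "(Q * P) $$ (k, l) = (\<Sum>i = 0..<n. Q $$ (k, i) * P $$ (i, l))"
        using P Q k that by (auto simp: scalar_prod_def intro!: sum.cong)
      also have "\<dots> = (\<Sum>i = 0..<n. Q $$ (k, i) * t l)"
        using const that by (intro sum.cong) auto
      finally show ?thesis by (simp add: q_def sum_distrib_right)
    qed
    have "q \<noteq> 0" using QP[OF k(1) s(1)] inv k by auto
    moreover have "t k' \<noteq> 0"
    proof
      assume "t k' = 0"
      then have "?s k' = 0" using const[OF _ k(2) s(2)] by simp
      then show False using s by simp
    qed
    moreover have "(Q * P) $$ (k, k') = 0" using inv k \<open>k \<noteq> k'\<close> by simp
    ultimately show False using QP[OF k(2) s(2)] by simp
  qed
  show thesis
  proof (cases "\<exists>c < n. ?s c \<noteq> 0")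
    case True
    then obtain c where "c < n" "?s c \<noteq> 0" by blast
    then show thesis using uniq that[of c] by blast
  next
    case False
    then show thesis using that[of 0] by blast
  qed
qed

section \<open>Divisibility conditions from sign vectors\<close>

text \<open>Moves the sum from the reals to the naturals, where every term is a multiple of
  \<open>c\<close>. It serves with \<open>c = 2\<close> for one sign vector and \<open>c = 4\<close>
  for a pair.\<close>

lemma sum_two_valued:
  fixes h :: "'b \<Rightarrow> real"
  assumes "finite A" "\<And>i. i \<in> A \<Longrightarrow> h i = 0 \<or> h i = real c" "sum h A = real n"
  shows "c dvd n"
proof -
  have "sum h A = (\<Sum>i\<in>A. real (if h i = 0 then 0 else c))"
    using assms(2) by (intro sum.cong) auto
  then have "real n = real (\<Sum>i\<in>A. if h i = 0 then 0 else c)"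
    using assms(3) by simp
  then have "n = (\<Sum>i\<in>A. if h i = 0 then 0 else c)" by (simp only: of_nat_eq_iff)
  also have "c dvd \<dots>" by (intro dvd_sum) auto
  finally show ?thesis .
qed

text \<open>The terms \<open>1 + f i\<close> are 0 or 2 and add up to \<open>n\<close>.\<close>

lemma even_if_sign_sum_zero:
  fixes f :: "nat \<Rightarrow> real"
  assumes "\<And>i. i < n \<Longrightarrow> f i \<in> {-1, 1}" "(\<Sum>i = 0..<n. f i) = 0"
  shows "even n"
proof (rule sum_two_valued)
  show "(\<Sum>i = 0..<n. 1 + f i) = real n" using assms by (simp add: sum.distrib)
qed (use assms in force)+

text \<open>Each term of \<open>\<Sum>i. (1 + f i) * (1 + g i) = n\<close> is 0 or 4.\<close>

lemma four_dvd_if_orthogonal_signs: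
  fixes f g :: "nat \<Rightarrow> real"
  assumes fg: "\<And>i. i < n \<Longrightarrow> f i \<in> {-1, 1}" "\<And>i. i < n \<Longrightarrow> g i \<in> {-1, 1}"
    and sums: "(\<Sum>i = 0..<n. f i) = 0" "(\<Sum>i = 0..<n. g i) = 0" "(\<Sum>i = 0..<n. f i * g i) = 0"
  shows "4 dvd n"
proof (rule sum_two_valued)
  show "(\<Sum>i = 0..<n. (1 + f i) * (1 + g i)) = real n"
    using sums by (simp add: algebra_simps sum.distrib)
  show "(1 + f i) * (1 + g i) = 0 \<or> (1 + f i) * (1 + g i) = real 4" if "i \<in> {0..<n}" for i
    proof -
    have "f i = -1 \<or> f i = 1" "g i = -1 \<or> g i = 1" using fg[of i] that by auto
    then show ?thesis by (elim disjE) simp_all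
  qed
qed simp

section \<open>Explicit diagonalizing matrices: path and double star\<close>

text \<open>An all-ones column followed by the oriented incidence matrix of the path through 0, ...,
  \<open>n - 1\<close>.\<close>

definition path_matrix :: "nat \<Rightarrow> real mat" where
  "path_matrix n = mat n n
     (\<lambda>(i, k). if k = 0 then 1 else if Suc i = k then 1 else if i = k then -1 else 0)"

lemma path_matrix_diagonalizes:
  "diagonalizes_over {-1, 0, 1} (complete_laplacian n) (path_matrix n)"
proof (rule diagonalizes_complete_laplacianI)
  show P: "path_matrix n \<in> carrier_mat n n" by (simp add: path_matrix_def)
  \<comment> \<open>Serves twice: weights 1 give the column sums, and a vector orthogonal to all
    columns is seen to agree at neighbouring path vertices.\<close>
  have weighted: "(\<Sum>j = 0..<n. path_matrix n $$ (j, k) * y j) = y (k - 1) - y k"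
    if k: "k < n" "k \<noteq> 0" for k and y :: "nat \<Rightarrow> real"
  proof -
    have "(\<Sum>j = 0..<n. path_matrix n $$ (j, k) * y j)
        = (\<Sum>j = 0..<n. (if j = k - 1 then y j else 0) - (if j = k then y j else 0))"
      using k by (intro sum.cong) (auto simp: path_matrix_def)
    also have "\<dots> = y (k - 1) - y k" using k by (simp add: sum_subtractf)
    finally show ?thesis .
  qed
  show "(\<Sum>j = 0..<n. path_matrix n $$ (j, k)) = 0" if "k < n" "k \<noteq> 0" for k
    using weighted[OF that, of "\<lambda>_. 1"] by simp
  show "det (path_matrix n) \<noteq> 0"
  proof (rule det_nonzero_if_row_kernel_trivial[OF P])
    fix y :: "nat \<Rightarrow> real" and i
    assume y: "\<And>k. k < n \<Longrightarrow> (\<Sum>j = 0..<n. path_matrix n $$ (j, k) * y j) = 0" and i: "i < n"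
    \<comment> \<open>The path is connected, so \<open>y\<close> is constant; orthogonality to the
      all-ones column then makes the constant zero.\<close>
    define a where "a = y 0"
    have const: "j < n \<Longrightarrow> y j = a" for j
    proof (induction j)
      case (Suc j)
      then show ?case using y[of "Suc j"] weighted[of "Suc j" y] by simp
    qed (simp add: a_def)
    have "0 = (\<Sum>j = 0..<n. path_matrix n $$ (j, 0) * y j)" using y[of 0] i by simp
    also have "\<dots> = (\<Sum>j = 0..<n. a)"
      using i const by (intro sum.cong) (auto simp: path_matrix_def)
    finally show "y i = 0" using i const[of i] by simp
  qed
qed (auto simp: path_matrix_def)

text \<open>Path edges whose indices differ by at least 2 share no vertex, and the all-ones column
  is orthogonal to every edge column because the latter sums to zero.\<close>

lemma path_matrix_bandwidth:
  "matrix_bandwidth (transpose_mat (path_matrix n) * path_matrix n) \<le> 2"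
proof (rule matrix_bandwidth_le)
  have P: "path_matrix n \<in> carrier_mat n n" by (simp add: path_matrix_def)
  have far: "(\<Sum>l = 0..<n. path_matrix n $$ (l, i) * path_matrix n $$ (l, j)) = 0"
    if ij: "j < n" "i + 2 \<le> j" for i j
  proof (cases "i = 0")
    case True
    have "(\<Sum>l = 0..<n. path_matrix n $$ (l, i) * path_matrix n $$ (l, j))
       = (\<Sum>l = 0..<n. (if l = j - 1 then 1 else 0) - (if l = j then 1 else 0))"
      using ij True by (intro sum.cong) (auto simp: path_matrix_def)
    also have "\<dots> = 0" using ij by (simp add: sum_subtractf)
    finally show ?thesis .
  next
    case False
    then show ?thesis using ij by (intro sum.neutral) (auto simp: path_matrix_def)
  qed
  fix i j assume "i < dim_row (transpose_mat (path_matrix n) * path_matrix n)"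
    "j < dim_col (transpose_mat (path_matrix n) * path_matrix n)"
    and dist: "\<bar>int i - int j\<bar> \<ge> int 2"
  then have ij: "i < n" "j < n" using P by auto
  consider "i + 2 \<le> j" | "j + 2 \<le> i" using dist by linarith
  then show "(transpose_mat (path_matrix n) * path_matrix n) $$ (i, j) = 0"
    unfolding transpose_times_index[OF P ij] using far[of j i] far[of i j] ij
    by cases (auto simp: mult.commute)
qed simp

text \<open>The last column of this matrix of order \<open>2 * m\<close> has \<open>m\<close> entries \<open>1\<close> followed by
  \<open>m\<close> entries \<open>-1\<close>. Every column between the first and the last exchanges one \<open>1\<close> and one \<open>-1\<close> of
  it, along the edges of a double star centred at \<open>0\<close> and \<open>m\<close> which spans all rows but the last.\<close>

definition balanced_sign :: "nat \<Rightarrow> nat \<Rightarrow> real" where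
  "balanced_sign m i = (if i < m then 1 else -1)"

definition double_star_matrix :: "nat \<Rightarrow> real mat" where
  "double_star_matrix m = mat (2 * m) (2 * m) (\<lambda>(i, k).
     if k = 0 then 1
     else if k = 2 * m - 1 then balanced_sign m i
     else if k < m then (if i = k \<or> i = m then - balanced_sign m i else balanced_sign m i)
     else (if i = 0 \<or> i = k then - balanced_sign m i else balanced_sign m i))"

lemma sum_balanced_sign: "(\<Sum>j = 0..<2 * m. balanced_sign m j) = 0"
proof -
  have "{0..<2 * m} = {0..<m} \<union> {m..<2 * m}" by auto
  then have "(\<Sum>j = 0..<2 * m. balanced_sign m j)
      = (\<Sum>j = 0..<m. balanced_sign m j) + (\<Sum>j = m..<2 * m. balanced_sign m j)"
    by (simp add: sum.union_disjoint)
  then show ?thesis by (simp add: balanced_sign_def)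
qed

lemma double_star_matrix_diagonalizes:
  assumes m: "m \<ge> 1"
  shows "diagonalizes_over {-1, 1} (complete_laplacian (2 * m)) (double_star_matrix m)"
proof (rule diagonalizes_complete_laplacianI)
  let ?P = "double_star_matrix m" and ?w = "balanced_sign m"
  show P: "?P \<in> carrier_mat (2 * m) (2 * m)" by (simp add: double_star_matrix_def)
  have last: "(\<Sum>j = 0..<2 * m. ?P $$ (j, 2 * m - 1) * y j) = (\<Sum>j = 0..<2 * m. ?w j * y j)"
    for y :: "nat \<Rightarrow> real"
  proof (intro sum.cong refl)
    fix j assume "j \<in> {0..<2 * m}"
    moreover have "2 * m - 1 < 2 * m" "2 * m - 1 \<noteq> 0" using m by simp_all
    ultimately show "?P $$ (j, 2 * m - 1) * y j = ?w j * y j"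
      unfolding double_star_matrix_def by simp
  qed
  \<comment> \<open>\<open>?w\<close> is 1 at \<open>k\<close> and -1 at \<open>m\<close>, so
    negating both entries subtracts 2 at \<open>k\<close> and adds 2 at \<open>m\<close>. In
    \<open>right\<close> the vertices 0 and \<open>k\<close> play these parts.\<close>
  have left: "(\<Sum>j = 0..<2 * m. ?P $$ (j, k) * y j)
      = (\<Sum>j = 0..<2 * m. ?w j * y j) - 2 * y k + 2 * y m"
    if k: "k < m" "k \<noteq> 0" for k and y :: "nat \<Rightarrow> real"
  proof -
    have "(\<Sum>j = 0..<2 * m. ?P $$ (j, k) * y j) = (\<Sum>j = 0..<2 * m. ?w j * y j
        - (if j = k then 2 * y j else 0) + (if j = m then 2 * y j else 0))"
      using k by (intro sum.cong) (auto simp: double_star_matrix_def balanced_sign_def)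
    then show ?thesis using k by (simp add: sum.distrib sum_subtractf)
  qed
  have right: "(\<Sum>j = 0..<2 * m. ?P $$ (j, k) * y j)
      = (\<Sum>j = 0..<2 * m. ?w j * y j) - 2 * y 0 + 2 * y k"
    if k: "m \<le> k" "k < 2 * m - 1" for k and y :: "nat \<Rightarrow> real"
  proof -
    have "(\<Sum>j = 0..<2 * m. ?P $$ (j, k) * y j) = (\<Sum>j = 0..<2 * m. ?w j * y j
        - (if j = 0 then 2 * y j else 0) + (if j = k then 2 * y j else 0))"
      using k by (intro sum.cong) (auto simp: double_star_matrix_def balanced_sign_def)
    then show ?thesis using k by (simp add: sum.distrib sum_subtractf)
  qed
  show "(\<Sum>j = 0..<2 * m. ?P $$ (j, k)) = 0" if k: "k < 2 * m" "k \<noteq> 0" for k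
  proof -
    consider "k = 2 * m - 1" | "k < m" | "m \<le> k" "k < 2 * m - 1"
      using k by linarith
    then show ?thesis
      using last[of "\<lambda>_. 1"] left[of k "\<lambda>_. 1"] right[of k "\<lambda>_. 1"] k sum_balanced_sign[of m]
      by cases simp_all
  qed
  show "det ?P \<noteq> 0"
  proof (rule det_nonzero_if_row_kernel_trivial[OF P])
    fix y :: "nat \<Rightarrow> real" and i
    assume y: "\<And>k. k < 2 * m \<Longrightarrow> (\<Sum>j = 0..<2 * m. ?P $$ (j, k) * y j) = 0" and i: "i < 2 * m"
    have w: "(\<Sum>j = 0..<2 * m. ?w j * y j) = 0" using y[of "2 * m - 1"] last[of y] m by simp
    have "(\<Sum>j = 0..<2 * m. y j) = (\<Sum>j = 0..<2 * m. ?P $$ (j, 0) * y j)"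
      by (intro sum.cong) (auto simp: double_star_matrix_def)
    then have sum: "(\<Sum>j = 0..<2 * m. y j) = 0" using y[of 0] m by simp
    define a where "a = y 0"
    \<comment> \<open>Orthogonality to \<open>?w\<close> and to an edge column equates
      \<open>y\<close> at the two ends of the edge: first along the edges at 0, which reach
      \<open>m\<close>, then along those at \<open>m\<close>.\<close>
    have R: "y k = a" if "m \<le> k" "k < 2 * m - 1" for k
      using right[OF that, of y] y[of k] w that by (simp add: a_def)
    have const: "y k = a" if "k < 2 * m - 1" for k
    proof (cases "k < m \<and> k \<noteq> 0")
      case True
      moreover from this have "m < 2 * m - 1" by linarith
      ultimately show ?thesis using left[of k y] y[of k] w R[of m] that by simp
    qed (use R that a_def in force)
    define b where "b = y (2 * m - 1)"
    \<comment> \<open>Only the last value \<open>b\<close> can still differ from \<open>a\<close>.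
      The weights \<open>?w\<close>, of sum zero, give \<open>b = a\<close>; the weights 1 then give
      \<open>a = 0\<close>.\<close>
    have split: "(\<Sum>j = 0..<2 * m. f j * y j) = a * (\<Sum>j = 0..<2 * m. f j) + f (2 * m - 1) * (b - a)"
      for f :: "nat \<Rightarrow> real"
    proof -
      have "(\<Sum>j = 0..<2 * m. f j * y j)
          = (\<Sum>j = 0..<2 * m. a * f j + (if j = 2 * m - 1 then f j * (b - a) else 0))"
        using const by (intro sum.cong) (auto simp: b_def algebra_simps)
      then show ?thesis using m by (simp add: sum.distrib sum_distrib_left)
    qed
    have b: "b = a"
      using split[of ?w] w m sum_balanced_sign[of m] by (auto simp: balanced_sign_def split: if_splits)
    then have "a = 0" using split[of "\<lambda>_. 1"] sum m by simp
    then show "y i = 0" using const[of i] b i unfolding b_def by (cases "i = 2 * m - 1") auto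
  qed
qed (auto simp: double_star_matrix_def balanced_sign_def)

section \<open>Bandwidth bounds for sign matrices\<close>

text \<open>Only the two corner entries lie \<open>n - 1\<close> or more off the diagonal, and both
  equal the sum of the last column.\<close>

lemma sign_bandwidth_upper:
  assumes P: "P \<in> carrier_mat n n" and n: "n \<ge> 2"
    and const: "\<And>i. i < n \<Longrightarrow> P $$ (i, 0) = 1"
    and zero: "(\<Sum>j = 0..<n. P $$ (j, n - 1)) = 0"
  shows "matrix_bandwidth (transpose_mat P * P) \<le> n - 1"
proof (rule matrix_bandwidth_le)
  fix i j assume "i < dim_row (transpose_mat P * P)" "j < dim_col (transpose_mat P * P)"
    and dist: "\<bar>int i - int j\<bar> \<ge> int (n - 1)"
  then have ij: "i < n" "j < n" using P by auto
  have "i = 0 \<and> j = n - 1 \<or> i = n - 1 \<and> j = 0" using ij dist n by linarith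
  moreover have "(\<Sum>k = 0..<n. P $$ (k, 0) * P $$ (k, n - 1)) = 0"
    using zero const by simp
  ultimately show "(transpose_mat P * P) $$ (i, j) = 0"
    unfolding transpose_times_index[OF P ij] by (auto simp: mult.commute)
qed (use n in simp)

text \<open>Apart from one column, all pairs of columns have nonzero inner product; deleting one of \<open>n\<close>
  indices leaves two that are at least \<open>n - 2\<close> apart.\<close>

lemma sign_bandwidth_lower:
  assumes D: "diagonalizes_over {-1, 1} (complete_laplacian n) P" and n: "n mod 4 = 2"
  shows "n - 1 \<le> matrix_bandwidth (transpose_mat P * P)"
proof -
  have P: "P \<in> carrier_mat n n" and S: "\<And>i j. i < n \<Longrightarrow> j < n \<Longrightarrow> P $$ (i, j) \<in> {-1, 1}"
    using D unfolding diagonalizes_over_def by auto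
  obtain c where c: "\<And>k. k < n \<Longrightarrow> k \<noteq> c \<Longrightarrow> (\<Sum>j = 0..<n. P $$ (j, k)) = 0"
    using diagonalizes_complete_laplacianD[OF D] by blast
  have near: "\<bar>int i - int j\<bar> < int (matrix_bandwidth (transpose_mat P * P))"
    if ij: "i < n" "j < n" "i \<noteq> c" "j \<noteq> c" for i j
  proof (rule matrix_bandwidth_less_imp_zero)
    show "(transpose_mat P * P) $$ (i, j) \<noteq> 0"
      unfolding transpose_times_index[OF P ij(1,2)]
    proof
      assume "(\<Sum>k = 0..<n. P $$ (k, i) * P $$ (k, j)) = 0"
      then have "4 dvd n"
        using four_dvd_if_orthogonal_signs[of n "\<lambda>k. P $$ (k, i)" "\<lambda>k. P $$ (k, j)"] S c ij by blast
      then show False using n by simp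
    qed
  qed (use ij P in auto)
  have n2: "n \<ge> 2" using n by (cases "n < 2") auto
  show ?thesis
  proof (cases "n = 2")
    case True
    then show ?thesis using matrix_bandwidth_ge_1 by simp
  next
    case False
    then have n3: "n \<ge> 3" using n2 by simp
    \<comment> \<open>The extreme indices other than \<open>c\<close> are at least
      \<open>n - 2\<close> apart; as \<open>near\<close> is strict, this suffices.\<close>
    consider "c = 0" | "c = n - 1" | "c \<noteq> 0" "c \<noteq> n - 1" by blast
    then show ?thesis
    proof cases
      case 1
      then show ?thesis using near[of 1 "n - 1"] n3 by auto
    next
      case 2
      then have "n - 2 \<noteq> c" using n3 by simp
      then show ?thesis using near[of 0 "n - 2"] n3 2 by auto
    next
      case 3
      then show ?thesis using near[of 0 "n - 1"] n3 by auto
    qed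
  qed
qed

section \<open>Hadamard matrices\<close>

lemma hadamard_diagonalizes:
  assumes H: "hadamard_matrix n H" and n: "n \<ge> 1"
  obtains P where "diagonalizes_over {-1, 1} (complete_laplacian n) P"
    "matrix_bandwidth (transpose_mat P * P) = 1"
proof -
  have carrier: "H \<in> carrier_mat n n" and S: "\<And>i j. i < n \<Longrightarrow> j < n \<Longrightarrow> H $$ (i, j) \<in> {-1, 1}"
    using H unfolding hadamard_matrix_def by auto
  have orth: "(\<Sum>k = 0..<n. H $$ (k, i) * H $$ (k, j)) = 0" if "i < n" "j < n" "i \<noteq> j" for i j
  proof -
    have "col H i \<bullet> col H j = (\<Sum>k = 0..<n. H $$ (k, i) * H $$ (k, j))"
      using carrier that by (auto simp: scalar_prod_def intro!: sum.cong)
    then show ?thesis using H that unfolding hadamard_matrix_def by auto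
  qed
  \<comment> \<open>Multiplying each row by its own first entry makes the first column all ones.
    Signs square to 1, so the inner products of columns do not change.\<close>
  define P where "P = mat n n (\<lambda>(i, j). H $$ (i, 0) * H $$ (i, j))"
  have P: "P \<in> carrier_mat n n" by (simp add: P_def)
  have sq: "H $$ (k, i) * H $$ (k, i) = 1" if "k < n" "i < n" for k i
    using S[OF that] by auto
  have PS: "P $$ (i, j) \<in> {-1, 1}" if "i < n" "j < n" for i j
    using S[of i 0] S[of i j] that by (auto simp: P_def)
  have gram: "(transpose_mat P * P) $$ (i, j) = (if i = j then real n else 0)"
    if ij: "i < n" "j < n" for i j
  proof -
    have "(transpose_mat P * P) $$ (i, j)
        = (\<Sum>k = 0..<n. (H $$ (k, 0) * H $$ (k, 0)) * (H $$ (k, i) * H $$ (k, j)))"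
      unfolding transpose_times_index[OF P ij]
      using ij by (intro sum.cong) (auto simp: P_def algebra_simps)
    also have "\<dots> = (\<Sum>k = 0..<n. H $$ (k, i) * H $$ (k, j))"
      using sq n by (intro sum.cong) auto
    finally show ?thesis using orth ij sq by auto
  qed
  \<comment> \<open>The Gram matrix is a nonzero multiple of the identity, which yields
    invertibility here; its diagonal form also gives bandwidth 1 below.\<close>
  have "transpose_mat P * P = real n \<cdot>\<^sub>m 1\<^sub>m n"
    using P gram by (intro eq_matI) auto
  then have "det P * det P = real n ^ n"
    using det_mult[of "transpose_mat P" n P] det_transpose[OF P] P by simp
  then have det: "det P \<noteq> 0" using n by auto
  have "diagonalizes_over {-1, 1} (complete_laplacian n) P"
  proof (rule diagonalizes_complete_laplacianI[OF P PS det])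
    show "P $$ (i, 0) = 1" if "i < n" for i using sq that n by (simp add: P_def)
    show "(\<Sum>j = 0..<n. P $$ (j, k)) = 0" if "k < n" "k \<noteq> 0" for k
    proof -
      have "(\<Sum>j = 0..<n. P $$ (j, k)) = (\<Sum>j = 0..<n. H $$ (j, 0) * H $$ (j, k))"
        using that by (intro sum.cong) (auto simp: P_def)
      then show ?thesis using orth[of 0 k] that by simp
    qed
  qed
  moreover have "matrix_bandwidth (transpose_mat P * P) \<le> 1"
    using gram P by (intro matrix_bandwidth_le) auto
  ultimately show thesis
    using that matrix_bandwidth_ge_1[of "transpose_mat P * P"] by force
qed

section \<open>Diagonalizability over signs and the combined result\<close>

lemma sign_diagonalizable_iff:
  assumes n: "n \<ge> 1"
  shows "(\<exists>P. diagonalizes_over {-1, 1} (complete_laplacian n) P) \<longleftrightarrow> n = 1 \<or> even n"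
proof
  assume "\<exists>P. diagonalizes_over {-1, 1} (complete_laplacian n) P"
  then obtain P where D: "diagonalizes_over {-1, 1} (complete_laplacian n) P" by blast
  have S: "\<And>i j. i < n \<Longrightarrow> j < n \<Longrightarrow> P $$ (i, j) \<in> {-1, 1}"
    using D unfolding diagonalizes_over_def by auto
  obtain c where c: "\<And>k. k < n \<Longrightarrow> k \<noteq> c \<Longrightarrow> (\<Sum>j = 0..<n. P $$ (j, k)) = 0"
    using diagonalizes_complete_laplacianD[OF D] by blast
  have "even n" if "n \<noteq> 1"
  proof -
    \<comment> \<open>At least one of the columns 0 and 1 differs from the exceptional column
      \<open>c\<close>, and both exist since \<open>n\<close> is at least 2.\<close>
    define k where "k = (if c = 0 then 1 else 0 :: nat)"
    have k: "k < n" "k \<noteq> c" using that n by (auto simp: k_def)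
    show ?thesis
      by (rule even_if_sign_sum_zero[of n "\<lambda>i. P $$ (i, k)"]) (use S c k in auto)
  qed
  then show "n = 1 \<or> even n" by blast
next
  assume "n = 1 \<or> even n"
  then show "\<exists>P. diagonalizes_over {-1, 1} (complete_laplacian n) P"
  proof
    assume "n = 1"
    \<comment> \<open>With a single column, orthogonality is vacuous.\<close>
    then have "hadamard_matrix n (1\<^sub>m 1)" unfolding hadamard_matrix_def by auto
    then show ?thesis using hadamard_diagonalizes n by blast
  next
    assume "even n"
    then obtain m where "n = 2 * m" by blast
    then show ?thesis using double_star_matrix_diagonalizes[of m] n by auto
  qed
qed

theorem theorem4p3:
  fixes n :: nat and G :: "('a, 'b) pre_digraph" and vs :: "'a list"
  assumes "n \<ge> 1"
    and "complete_digraph n G"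
    and "distinct vs" and "set vs = verts G"
  shows "(S_diagonalizable {-1, 0, 1} G vs \<and> S_bandwidth {-1, 0, 1} G vs \<le> 2)
    \<and> (S_diagonalizable {-1, 1} G vs \<longleftrightarrow> n = 1 \<or> even n)
    \<and> (n mod 4 = 2 \<longrightarrow> S_bandwidth {-1, 1} G vs = enat (n - 1))
    \<and> ((\<exists>H. hadamard_matrix n H) \<longrightarrow> S_bandwidth {-1, 1} G vs = 1)"
proof (intro conjI impI)
  have L: "laplacian_matrix G vs = complete_laplacian n"
    using laplacian_matrix_complete assms by blast
  show "S_diagonalizable {-1, 0, 1} G vs"
    unfolding S_diagonalizable_def L using path_matrix_diagonalizes by blast
  have "S_bandwidth {-1, 0, 1} G vs
      \<le> enat (matrix_bandwidth (transpose_mat (path_matrix n) * path_matrix n))"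
    using path_matrix_diagonalizes L by (intro S_bandwidth_le) simp
  also have "\<dots> \<le> enat 2" using path_matrix_bandwidth by simp
  finally show "S_bandwidth {-1, 0, 1} G vs \<le> 2" by (simp add: numeral_eq_enat)
  show "S_diagonalizable {-1, 1} G vs \<longleftrightarrow> n = 1 \<or> even n"
    unfolding S_diagonalizable_def L using sign_diagonalizable_iff assms(1) by blast
  show "S_bandwidth {-1, 1} G vs = enat (n - 1)" if n: "n mod 4 = 2"
  proof (rule antisym)
    have "even n" using n by presburger
    then obtain m where m: "n = 2 * m" by blast
    \<comment> \<open>Its constant column stands first and a column of sum zero last, so its corner
      Gram entries vanish and it attains the lower bound.\<close>
    let ?P = "double_star_matrix m"
    have m1: "m \<ge> 1" using assms(1) m by simp
    have P: "?P \<in> carrier_mat n n" by (simp add: double_star_matrix_def m)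
    have "(\<Sum>j = 0..<n. ?P $$ (j, n - 1)) = (\<Sum>j = 0..<n. balanced_sign m j)"
    proof (intro sum.cong refl)
      fix j assume "j \<in> {0..<n}"
      moreover have "2 * m - 1 < 2 * m" "2 * m - 1 \<noteq> 0" using m1 by simp_all
      ultimately show "?P $$ (j, n - 1) = balanced_sign m j"
        unfolding double_star_matrix_def m by simp
    qed
    then have "matrix_bandwidth (transpose_mat ?P * ?P) \<le> n - 1"
      using m m1 sum_balanced_sign[of m]
      by (intro sign_bandwidth_upper[OF P]) (auto simp: double_star_matrix_def)
    moreover have "S_bandwidth {-1, 1} G vs \<le> enat (matrix_bandwidth (transpose_mat ?P * ?P))"
      using double_star_matrix_diagonalizes[OF m1] L m by (intro S_bandwidth_le) simp
    ultimately show "S_bandwidth {-1, 1} G vs \<le> enat (n - 1)"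
      by (meson enat_ord_simps(1) order_trans)
    show "enat (n - 1) \<le> S_bandwidth {-1, 1} G vs"
      using sign_bandwidth_lower n by (intro S_bandwidth_ge) (simp add: L)
  qed
  show "S_bandwidth {-1, 1} G vs = 1" if ex: "\<exists>H. hadamard_matrix n H"
  proof (rule antisym)
    obtain H where "hadamard_matrix n H" using ex by blast
    then obtain P where "diagonalizes_over {-1, 1} (complete_laplacian n) P"
      and bw: "matrix_bandwidth (transpose_mat P * P) = 1"
      using hadamard_diagonalizes assms(1) by blast
    then have "diagonalizes_over {-1, 1} (laplacian_matrix G vs) P" by (simp add: L)
    from S_bandwidth_le[OF this] show "S_bandwidth {-1, 1} G vs \<le> 1"
      by (simp add: bw one_enat_def)
    show "1 \<le> S_bandwidth {-1, 1} G vs"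
      unfolding one_enat_def by (intro S_bandwidth_ge matrix_bandwidth_ge_1)
  qed
qed

end
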